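(* (i) The subgraphs of $\mathcal{E}_2$ induced on the vertices lying on $\{y\omega_2:0\le y<1\}$ and induced on the vertices lying on $\{1+y\omega_2:0\le y<1\}$ are each isomorphic to the Farey graph defined on $\mathbb{I}_4$ associated with $H_4$. (ii) The subgraphs of $\mathcal{E}_7$ induced on the vertices lying on $\{y\omega_7:0\le y<1\}$ and induced on the vertices lying on $\{1+y(\omega_7-1):0\le y<1\}$ are each isomorphic to the Farey graph defined on $\mathbb{I}_4$ associated with $H_4$. (iii) The subgraphs of $\mathcal{E}_{11}$ induced on the vertices lying on $\{y\omega_{11}:0\le y<1\}$ and induced on the vertices lying on $\{1+y(\omega_{11}-1):0\le y<1\}$ are each isomorphic to the Farey graph defined on $\mathbb{I}_6$ associated with $H_6$.
   Context: $\omega_2=\sqrt{-2}$, $\omega_7=\frac{1+\sqrt{-7}}2$, $\omega_{11}=\frac{1+\sqrt{-11}}2$; $\mathbb{Z}[\omega_d]$ is the ring of integers of $\mathbb{Q}(\sqrt{-d})$. The Farey graph $\mathcal{E}_d$ has vertex set $\mathbb{Q}(\sqrt{-d})\cup\{\infty\}$ and edges $A(\infty)\to A(0)$ for $A\in\mathrm{PSL}(2,\mathbb{Z}[\omega_d])$ acting by Möbius transformations. The Hecke groups are $H_4=\left\langle\begin{pmatrix}0&1\\-1&0\end{pmatrix},\begin{pmatrix}1&\sqrt2\\0&1\end{pmatrix}\right\rangle$ and $H_6=\left\langle\begin{pmatrix}0&1\\-1&0\end{pmatrix},\begin{pmatrix}1&\sqrt3\\0&1\end{pmatrix}\right\rangle$,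 acting by real Möbius transformations on $\mathbb{R}\cup\{\infty\}$. The Farey graph associated with $H_\ell$ ($\ell\in\{4,6\}$) is the graph with vertex set $H_\ell(\infty)$ and edges $A(\infty)\to A(0)$, $A\in H_\ell$. Let $\mathbb{I}_4=[0,\sqrt2)$, $\mathbb{I}_6=[0,\sqrt3)$; the Farey graph defined on $\mathbb{I}_\ell$ associated with $H_\ell$ is the subgraph induced on the vertices in $\mathbb{I}_\ell$. *)

theory Defs
  imports
    "HOL-Analysis.Analysis"
    "HOL-Algebra.Generated_Groups"
    "Graph_Theory.Digraph_Isomorphism"
begin

datatype 'a proj_line = Point 'a | Infty

fun moebius :: "'a::field^2^2 \<Rightarrow> 'a proj_line \<Rightarrow> 'a proj_line" where
  "moebius A Infty = (if A$2$1 = 0 then Infty else Point (A$1$1 / A$2$1))"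
| "moebius A (Point z) =
     (if A$2$1 * z + A$2$2 = 0 then Infty
      else Point ((A$1$1 * z + A$1$2) / (A$2$1 * z + A$2$2)))"

definition SL2 :: "'a::field set \<Rightarrow> ('a^2^2) monoid" where
  "SL2 R = \<lparr>carrier = {A. det A = 1 \<and> (\<forall>i j. A$i$j \<in> R)}, mult = (**), one = mat 1\<rparr>"

definition PSL2 :: "'a::field set \<Rightarrow> ('a^2^2) set monoid" where
  "PSL2 R = SL2 R Mod {mat 1, - mat 1}"

(* A and -A act identically, so the image below is a singleton; see psl_act_coset. *)
definition psl_act :: "('a::field^2^2) set \<Rightarrow> 'a proj_line \<Rightarrow> 'a proj_line" where
  "psl_act X z = the_elem ((\<lambda>A. moebius A z) ` X)"

lemma moebius_uminus: "moebius (- A) z = moebius A z"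
proof (cases z)
  case (Point w)
  have "(- A)$i$1 * w + (- A)$i$2 = - (A$i$1 * w + A$i$2)" for i
    by simp
  then show ?thesis
    unfolding Point moebius.simps by (simp only: neg_equal_0_iff_equal minus_divide_divide)
qed simp

lemma psl_act_coset: "psl_act ({mat 1, - mat 1} #>\<^bsub>SL2 R\<^esub> A) z = moebius A z"
proof -
  have "- mat 1 ** A = - A"
    by (simp add: vec_eq_iff matrix_matrix_mult_def mat_def sum_2 forall_2)
  then have "{mat 1, - mat 1} #>\<^bsub>SL2 R\<^esub> A = {A, - A}"
    by (auto simp: r_coset_def SL2_def)
  then show ?thesis
    by (simp add: psl_act_def moebius_uminus)
qed

definition omega :: "nat \<Rightarrow> complex" where
  "omega d = (if d mod 4 = 3 then (1 + \<i> * sqrt (real d)) / 2 else \<i> * sqrt (real d))"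

definition quad_field :: "nat \<Rightarrow> complex set" where
  "quad_field d = {of_rat a + of_rat b * (\<i> * sqrt (real d)) | a b. True}"

definition quad_ring :: "nat \<Rightarrow> complex set" where
  "quad_ring d = {of_int a + of_int b * omega d | a b. True}"

definition farey_quad :: "nat \<Rightarrow> (complex proj_line, complex proj_line \<times> complex proj_line) pre_digraph"
  where
  "farey_quad d =
     \<lparr>verts = Point ` quad_field d \<union> {Infty},
      arcs = {(psl_act A Infty, psl_act A (Point 0)) | A. A \<in> carrier (PSL2 (quad_ring d))},
      tail = fst, head = snd\<rparr>"

definition hecke_group :: "real \<Rightarrow> (real^2^2) set" where
  "hecke_group t = generate (SL2 UNIV)
     {vector [vector [0, 1], vector [-1, 0]], vector [vector [1, t], vector [0, 1]]}"

definition H4 :: "(real^2^2) set" where "H4 = hecke_group (sqrt 2)"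

definition H6 :: "(real^2^2) set" where "H6 = hecke_group (sqrt 3)"

definition farey_hecke :: "(real^2^2) set \<Rightarrow> (real proj_line, real proj_line \<times> real proj_line) pre_digraph"
  where
  "farey_hecke H =
     \<lparr>verts = (\<lambda>A. moebius A Infty) ` H,
      arcs = {(moebius A Infty, moebius A (Point 0)) | A. A \<in> H},
      tail = fst, head = snd\<rparr>"

definition induced_on :: "('a proj_line, 'b) pre_digraph \<Rightarrow> 'a set \<Rightarrow> ('a proj_line, 'b) pre_digraph"
  where "induced_on G S = G \<restriction> (verts G \<inter> Point ` S)"

definition farey_I4 :: "(real proj_line, real proj_line \<times> real proj_line) pre_digraph" where
  "farey_I4 = induced_on (farey_hecke H4) {0..<sqrt 2}"

definition farey_I6 :: "(real proj_line, real proj_line \<times> real proj_line) pre_digraph" where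
  "farey_I6 = induced_on (farey_hecke H6) {0..<sqrt 3}"

end

theory Submission
  imports Defs
begin

text \<open>Write \<open>m\<close> for the norm of \<open>\<theta>\<close>, the direction of the segment (\<open>\<omega>\<close> or \<open>\<omega> - 1\<close>); it is 2 or 3.
  The Hecke group with parameter \<open>sqrt m\<close> consists of the determinant-one matrices with rows
  \<open>(a, b sqrt m), (c sqrt m, d)\<close> or \<open>(a sqrt m, b), (c, d sqrt m)\<close> over the integers. Replacing
  \<open>sqrt m\<close> by \<open>\<theta>\<close> in the upper row and by its conjugate in the lower row turns them into
  determinant-one matrices over the ring of integers, so \<open>y sqrt m \<mapsto> y \<theta>\<close> preserves edges. Conversely a
  rational multiple of \<open>\<theta>\<close> has a reduced fraction \<open>p / (c cnj \<theta>)\<close> or \<open>p \<theta> / q\<close>, unique up to a factor in the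
  ring, so an edge makes the determinant of two such fractions a unit. If both have the same shape the
  determinant is an integer multiple of \<open>\<theta>\<close> or its conjugate, whose norm is not 1; otherwise it is an
  integer, hence \<open>\<plusminus>1\<close>. Translations by ring elements handle the segments starting at 1.\<close>

text \<open>The edge relation in the rational coordinate \<open>y\<close> of the points \<open>y sqrt m\<close> and \<open>y \<theta>\<close>.\<close>

definition farey_edge :: "int \<Rightarrow> real \<Rightarrow> real \<Rightarrow> bool" where
  "farey_edge m x y \<longleftrightarrow> (\<exists>a b c d :: int. c \<noteq> 0 \<and> d \<noteq> 0 \<and>
     (a * d - m * b * c = 1 \<and> x = a / (m * c) \<and> y = b / d \<or>
      m * a * d - b * c = 1 \<and> x = a / c \<and> y = b / (m * d)))"

lemma farey_edgeI1:
  fixes a b c d :: int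
  assumes "a * d - m * b * c = 1 \<or> a * d - m * b * c = -1" "c \<noteq> 0" "d \<noteq> 0"
    "x = a / (m * c)" "y = b / d"
  shows "farey_edge m x y"
proof -
  obtain b' d' :: int where "a * d' - m * b' * c = 1" "d' \<noteq> 0" "y = b' / d'"
    using assms(1) that[of d b] that[of "- d" "- b"] assms(3,5) by force
  with assms(2,4) show ?thesis
    unfolding farey_edge_def
    by (rule_tac exI[of _ a], rule_tac exI[of _ b'], rule_tac exI[of _ c], rule_tac exI[of _ d']) simp
qed

lemma farey_edgeI2:
  fixes a b c d :: int
  assumes "m * a * d - b * c = 1 \<or> m * a * d - b * c = -1" "c \<noteq> 0" "d \<noteq> 0"
    "x = a / c" "y = b / (m * d)"
  shows "farey_edge m x y"
proof -
  obtain b' d' :: int where "m * a * d' - b' * c = 1" "d' \<noteq> 0" "y = b' / (m * d')"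
    using assms(1) that[of d b] that[of "- d" "- b"] assms(3,5) by force
  with assms(2,4) show ?thesis
    unfolding farey_edge_def
    by (rule_tac exI[of _ a], rule_tac exI[of _ b'], rule_tac exI[of _ c], rule_tac exI[of _ d']) simp
qed

section \<open>Graphs parametrized by a common set of coordinates\<close>

lemma digraph_iso_parametrized:
  fixes E :: "'i \<Rightarrow> 'i \<Rightarrow> bool" and G :: "('a, 'a \<times> 'a) pre_digraph"
    and H :: "('b, 'b \<times> 'b) pre_digraph"
  assumes "inj_on g Y" "inj_on h Y"
    and G: "G = \<lparr>verts = g ` Y, arcs = {(g x, g y) | x y. x \<in> Y \<and> y \<in> Y \<and> E x y}, tail = fst, head = snd\<rparr>"
    and H: "H = \<lparr>verts = h ` Y, arcs = {(h x, h y) | x y. x \<in> Y \<and> y \<in> Y \<and> E x y}, tail = fst, head = snd\<rparr>"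
  shows "digraph_iso G H"
proof -
  \<comment> \<open>The isomorphism matches vertices with the same parameter. Arcs are pairs of
    vertices, so the map on arcs has to be \<open>map_prod f f\<close>.\<close>
  define f where "f = h \<circ> inv_into Y g"
  have f: "f (g y) = h y" if "y \<in> Y" for y
    using that assms(1) by (simp add: f_def)
  let ?f = "\<lparr>iso_verts = f, iso_arcs = map_prod f f, iso_head = snd, iso_tail = fst\<rparr>"
  have inj: "inj_on f (g ` Y)"
    using assms(1,2) f by (auto simp: inj_on_def)
  have G': "verts G = g ` Y" "tail G = fst" "head G = snd"
    by (simp_all add: G)
  have "inj_on (map_prod f f) (arcs G)"
    by (rule inj_on_subset[OF map_prod_inj_on[OF inj inj]]) (auto simp: G)
  moreover have "wf_digraph G"
    by (rule wf_digraph.intro) (auto simp: G)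
  ultimately have iso: "pre_digraph.digraph_isomorphism G ?f"
    using inj unfolding pre_digraph.digraph_isomorphism_def G' by simp
  have "map_prod f f ` arcs G = arcs H"
  proof (intro equalityI subsetI)
    fix e assume "e \<in> map_prod f f ` arcs G"
    then obtain x y where "e = map_prod f f (g x, g y)" "x \<in> Y" "y \<in> Y" "E x y"
      unfolding G by auto
    then show "e \<in> arcs H"
      unfolding H by (auto simp: f)
  next
    fix e assume "e \<in> arcs H"
    then obtain x y where xy: "e = (h x, h y)" "x \<in> Y" "y \<in> Y" "E x y"
      unfolding H by auto
    then have "e = map_prod f f (g x, g y)" "(g x, g y) \<in> arcs G"
      unfolding G by (auto simp: f)
    then show "e \<in> map_prod f f ` arcs G"
      by (rule image_eqI)
  qed
  moreover have "f ` verts G = verts H"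
    unfolding G H by (simp add: image_image f)
  ultimately have "H = app_iso ?f G"
    by (simp add: app_iso_def H)
  with iso show ?thesis
    unfolding digraph_iso_def by blast
qed

lemma induced_on_parametrized:
  assumes "verts G \<inter> Point ` S = g ` Y"
    and "\<And>x y. x \<in> Y \<Longrightarrow> y \<in> Y \<Longrightarrow> (g x, g y) \<in> arcs G \<longleftrightarrow> E x y"
    and "tail G = fst" "head G = snd"
  shows "induced_on G S =
    \<lparr>verts = g ` Y, arcs = {(g x, g y) | x y. x \<in> Y \<and> y \<in> Y \<and> E x y}, tail = fst, head = snd\<rparr>"
proof -
  have "{e \<in> arcs G. fst e \<in> g ` Y \<and> snd e \<in> g ` Y} =
      {(g x, g y) | x y. x \<in> Y \<and> y \<in> Y \<and> E x y}" (is "?A = ?B")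
  proof (intro equalityI subsetI)
    fix e assume "e \<in> ?A"
    then obtain x y where "e = (g x, g y)" "x \<in> Y" "y \<in> Y" "e \<in> arcs G"
      by (cases e) auto
    with assms(2) show "e \<in> ?B" by blast
  next
    fix e assume "e \<in> ?B"
    then obtain x y where xy: "e = (g x, g y)" "x \<in> Y" "y \<in> Y" "E x y" by blast
    with assms(2)[of x y] show "e \<in> ?A" by simp
  qed
  then show ?thesis
    by (simp only: induced_on_def induce_subgraph_def assms(1,3,4))
qed

section \<open>Hecke groups\<close>

definition mat2 :: "'a \<Rightarrow> 'a \<Rightarrow> 'a \<Rightarrow> 'a \<Rightarrow> ('a::field)^2^2" where
  "mat2 a b c d = vector [vector [a, b], vector [c, d]]"

lemma mat2_nth [simp]:
  "mat2 a b c d $ 1 $ 1 = a" "mat2 a b c d $ 1 $ 2 = b"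
  "mat2 a b c d $ 2 $ 1 = c" "mat2 a b c d $ 2 $ 2 = d"
  by (simp_all add: mat2_def)

lemma mat2_eta: "A = mat2 (A$1$1) (A$1$2) (A$2$1) (A$2$2)"
  by (simp add: vec_eq_iff forall_2)

lemma mat2_mult [simp]:
  "mat2 a b c d ** mat2 a' b' c' d' =
    mat2 (a * a' + b * c') (a * b' + b * d') (c * a' + d * c') (c * b' + d * d')"
  by (simp add: vec_eq_iff forall_2 matrix_matrix_mult_def sum_2)

lemma mat2_eq_iff [simp]:
  "mat2 a b c d = mat2 a' b' c' d' \<longleftrightarrow> a = a' \<and> b = b' \<and> c = c' \<and> d = d'"
  by (auto simp: vec_eq_iff forall_2)

lemma det_mat2 [simp]: "det (mat2 a b c d) = a * d - b * c"
  by (simp add: det_2)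

lemma mat_1_eq_mat2: "mat 1 = mat2 1 0 0 1"
  by (simp add: vec_eq_iff forall_2 mat_def)

lemma SL2_simps [simp]:
  "mat2 a b c d \<in> carrier (SL2 R) \<longleftrightarrow>
    a * d - b * c = 1 \<and> a \<in> R \<and> b \<in> R \<and> c \<in> R \<and> d \<in> R"
  "A \<otimes>\<^bsub>SL2 R\<^esub> B = A ** B" "\<one>\<^bsub>SL2 R\<^esub> = mat 1"
  by (auto simp: SL2_def forall_2)

lemma SL2_UNIV_group: "group (SL2 (UNIV :: 'a::field set))"
proof (rule groupI)
  fix A :: "'a^2^2" assume A: "A \<in> carrier (SL2 UNIV)"
  obtain a b c d where [simp]: "A = mat2 a b c d"
    using mat2_eta by blast
  have "mat2 d (- b) (- c) a \<in> carrier (SL2 UNIV)" "mat2 d (- b) (- c) a ** A = mat 1"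
    using A by (simp_all add: algebra_simps mat_1_eq_mat2)
  then show "\<exists>B\<in>carrier (SL2 UNIV). B \<otimes>\<^bsub>SL2 UNIV\<^esub> A = \<one>\<^bsub>SL2 UNIV\<^esub>"
    unfolding SL2_simps(2,3) by blast
qed (auto simp: SL2_def det_mul matrix_mul_assoc)

section \<open>Integral description of the Hecke groups\<close>

definition hecke_matrix :: "int \<Rightarrow> real^2^2 \<Rightarrow> bool" where
  "hecke_matrix m A \<longleftrightarrow> (\<exists>a b c d :: int.
     a * d - m * b * c = 1 \<and> A = mat2 (of_int a) (b * sqrt m) (c * sqrt m) (of_int d) \<or>
     m * a * d - b * c = 1 \<and> A = mat2 (a * sqrt m) (of_int b) (of_int c) (d * sqrt m))"

lemma hecke_matrixI1:
  "a * d - m * b * c = 1 \<Longrightarrow> p = of_int a \<Longrightarrow> q = b * sqrt m \<Longrightarrow> r = c * sqrt m \<Longrightarrow> s = of_int d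
    \<Longrightarrow> hecke_matrix m (mat2 p q r s)"
  and hecke_matrixI2:
  "m * a * d - b * c = 1 \<Longrightarrow> p = a * sqrt m \<Longrightarrow> q = of_int b \<Longrightarrow> r = of_int c \<Longrightarrow> s = d * sqrt m
    \<Longrightarrow> hecke_matrix m (mat2 p q r s)"
  unfolding hecke_matrix_def by blast+

lemma hecke_matrix_cases:
  assumes "hecke_matrix m A"
  obtains a b c d :: int where "a * d - m * b * c = 1"
    "A = mat2 (of_int a) (b * sqrt m) (c * sqrt m) (of_int d)"
  | a b c d :: int where "m * a * d - b * c = 1"
    "A = mat2 (a * sqrt m) (of_int b) (of_int c) (d * sqrt m)"
  using assms unfolding hecke_matrix_def by blast

text \<open>The two shapes multiply like signs: equal shapes give the first, different shapes the
  second. In a word in the generators the shape records the parity of the number of inversions. In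
  each of the four cases the integer determinant form of the product factors into those of
  \<open>A\<close> and \<open>B\<close>.\<close>

lemma hecke_matrix_mult:
  assumes "m \<ge> 0" "hecke_matrix m A" "hecke_matrix m B"
  shows "hecke_matrix m (A ** B)"
  using assms(2)
proof (cases rule: hecke_matrix_cases)
  case (1 a b c d)
  note A = this
  show ?thesis using assms(3)
  proof (cases rule: hecke_matrix_cases)
    case (1 a' b' c' d')
    have "(a * a' + m * b * c') * (m * c * b' + d * d') - m * (a * b' + b * d') * (c * a' + d * c') =
       (a * d - m * b * c) * (a' * d' - m * b' * c')"
      by (simp add: algebra_simps)
    also have "\<dots> = 1"
      using A(1) 1(1) by simp
    finally show ?thesis unfolding A(2) 1(2) mat2_mult
      by (rule hecke_matrixI1) (use assms(1) in \<open>simp_all add: algebra_simps\<close>)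
  next
    case (2 a' b' c' d')
    have "m * (a * a' + b * c') * (c * b' + d * d') - (a * b' + m * b * d') * (m * c * a' + d * c') =
       (a * d - m * b * c) * (m * a' * d' - b' * c')"
      by (simp add: algebra_simps)
    also have "\<dots> = 1"
      using A(1) 2(1) by simp
    finally show ?thesis unfolding A(2) 2(2) mat2_mult
      by (rule hecke_matrixI2) (use assms(1) in \<open>simp_all add: algebra_simps\<close>)
  qed
next
  case (2 a b c d)
  note A = this
  show ?thesis using assms(3)
  proof (cases rule: hecke_matrix_cases)
    case (1 a' b' c' d')
    have "m * (a * a' + b * c') * (c * b' + d * d') - (m * a * b' + b * d') * (c * a' + m * d * c') =
       (m * a * d - b * c) * (a' * d' - m * b' * c')"
      by (simp add: algebra_simps)
    also have "\<dots> = 1"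
      using A(1) 1(1) by simp
    finally show ?thesis unfolding A(2) 1(2) mat2_mult
      by (rule hecke_matrixI2) (use assms(1) in \<open>simp_all add: algebra_simps\<close>)
  next
    case (2 a' b' c' d')
    have "(m * a * a' + b * c') * (c * b' + m * d * d') - m * (a * b' + b * d') * (c * a' + d * c') =
       (m * a * d - b * c) * (m * a' * d' - b' * c')"
      by (simp add: algebra_simps)
    also have "\<dots> = 1"
      using A(1) 2(1) by simp
    finally show ?thesis unfolding A(2) 2(2) mat2_mult
      by (rule hecke_matrixI1) (use assms(1) in \<open>simp_all add: algebra_simps\<close>)
  qed
qed

lemma SL2_inv_mat2:
  assumes "a * d - b * c = (1 :: 'a::field)"
  shows "inv\<^bsub>SL2 UNIV\<^esub> (mat2 a b c d) = mat2 d (- b) (- c) a"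
  using assms
  by (intro group.inv_equality[OF SL2_UNIV_group]) (simp_all add: mat_1_eq_mat2 algebra_simps)

lemma hecke_group_mat2:
  "hecke_group t = generate (SL2 UNIV) {mat2 0 1 (-1) 0, mat2 1 t 0 1}"
  by (simp add: hecke_group_def mat2_def)

lemma hecke_group_subgroup: "subgroup (hecke_group t) (SL2 UNIV)"
  unfolding hecke_group_mat2
  by (rule group.generate_is_subgroup[OF SL2_UNIV_group]) simp

lemma hecke_group_gens: "mat2 0 1 (-1) 0 \<in> hecke_group t" "mat2 1 t 0 1 \<in> hecke_group t"
  unfolding hecke_group_mat2 by (auto intro: generate.incl)

lemma hecke_group_mult: "A \<in> hecke_group t \<Longrightarrow> B \<in> hecke_group t \<Longrightarrow> A ** B \<in> hecke_group t"
  using subgroup.m_closed[OF hecke_group_subgroup] by fastforce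

lemma hecke_group_translation_nat: "mat2 1 (real n * t) 0 1 \<in> hecke_group t"
proof (induction n)
  case 0
  then show ?case
    using subgroup.one_closed[OF hecke_group_subgroup] by (simp add: mat_1_eq_mat2)
next
  case (Suc n)
  then show ?case
    using hecke_group_mult[OF Suc hecke_group_gens(2)] by (simp add: algebra_simps)
qed

lemma hecke_group_translation: "mat2 1 (of_int n * t) 0 1 \<in> hecke_group t"
proof (cases "n \<ge> 0")
  case True
  then show ?thesis using hecke_group_translation_nat[of "nat n" t] by simp
next
  case False
  then show ?thesis
    using subgroup.m_inv_closed[OF hecke_group_subgroup hecke_group_translation_nat[of "nat (- n)" t]]
    by (simp add: SL2_inv_mat2)
qed

lemma hecke_group_imp_hecke_matrix:
  assumes "m \<ge> 0" "A \<in> hecke_group (sqrt (of_int m))"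
  shows "hecke_matrix m A"
  using assms(2) unfolding hecke_group_mat2
proof (induction rule: generate.induct)
  case one
  then show ?case by (auto simp: mat_1_eq_mat2 intro: hecke_matrixI1[of 1 1 m 0 0])
next
  case (incl h)
  then show ?case
    by (auto intro: hecke_matrixI1[of 1 1 m 1 0] hecke_matrixI2[of m 0 0 1 "-1"])
next
  case (inv h)
  have "hecke_matrix m (mat2 0 (- 1) 1 0)"
    by (rule hecke_matrixI2[of m 0 0 "-1" 1]) auto
  moreover have "hecke_matrix m (mat2 1 (- sqrt m) 0 1)"
    by (rule hecke_matrixI1[of 1 1 m "-1" 0]) auto
  ultimately show ?case
    using inv by (auto simp: SL2_inv_mat2)
next
  case (eng h1 h2)
  then show ?case using assms(1) by (simp add: hecke_matrix_mult)
qed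

section \<open>Euclidean descent on the lower left entry\<close>

lemma ex_translate_small:
  fixes d k :: int
  assumes "k \<noteq> 0"
  obtains n where "2 * \<bar>d + n * k\<bar> \<le> \<bar>k\<bar>"
proof -
  let ?r = "d mod \<bar>k\<bar>"
  have r: "0 \<le> ?r" "?r < \<bar>k\<bar>" using assms by auto
  have d: "?r = d - (d div \<bar>k\<bar>) * sgn k * k"
    using assms by (simp add: minus_mult_div_eq_mod[symmetric] abs_sgn algebra_simps)
  show thesis
  \<comment> \<open>Rounding to the nearest multiple: a remainder above half of the modulus is
    lowered by one further modulus. The factor \<open>sgn k\<close> turns multiples of the absolute
    value into multiples of \<open>k\<close> itself.\<close>
  proof (cases "2 * ?r \<le> \<bar>k\<bar>")
    case True
    then show ?thesis using r d by (intro that[of "- (d div \<bar>k\<bar>) * sgn k"]) simp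
  next
    case False
    have "d + (- (d div \<bar>k\<bar>) * sgn k - sgn k) * k = ?r - \<bar>k\<bar>"
      unfolding d by (simp add: algebra_simps abs_sgn)
    then show ?thesis using r False by (intro that[of "- (d div \<bar>k\<bar>) * sgn k - sgn k"]) simp
  qed
qed

text \<open>Euclid's algorithm on the lower row: right multiplication by a power of the translation
  makes the second entry at most \<open>sqrt m / 2 < 1\<close> times the first in absolute value.\<close>

lemma hecke_matrix_reduce:
  assumes m: "0 < m" "m < 4" and A: "hecke_matrix m A" and nz: "A$2$1 \<noteq> 0"
  obtains n :: int where "(A$2$2 + n * sqrt m * A$2$1)\<^sup>2 < (A$2$1)\<^sup>2"
  using A
proof (cases rule: hecke_matrix_cases)
  case (1 a b c d)
  then have c: "c \<noteq> 0" using nz by auto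
  obtain n where n: "2 * \<bar>d + n * (m * c)\<bar> \<le> \<bar>m * c\<bar>"
    using ex_translate_small[of "m * c" d] c m by auto
  have "4 * (d + n * (m * c))\<^sup>2 \<le> (m * c)\<^sup>2"
    using power_mono[OF n, of 2] by (simp add: power_mult_distrib)
  also have "\<dots> = m * (m * c\<^sup>2)" by (simp add: power2_eq_square)
  \<comment> \<open>The bound \<open>m < 4\<close> enters here: the squared half modulus falls
    strictly below the square \<open>m * c\<^sup>2\<close> of the lower left entry
    \<open>c * sqrt m\<close>.\<close>
  also have "\<dots> < 4 * (m * c\<^sup>2)" using m c by (intro mult_strict_right_mono) auto
  finally have "(d + n * (m * c))\<^sup>2 < m * c\<^sup>2" by simp
  then have "real_of_int ((d + n * (m * c))\<^sup>2) < real_of_int (m * c\<^sup>2)" by linarith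
  then show ?thesis using m 1 by (intro that[of n]) (simp add: power_mult_distrib algebra_simps)
next
  case (2 a b c d)
  then have c: "c \<noteq> 0" using nz by auto
  obtain n where n: "2 * \<bar>d + n * c\<bar> \<le> \<bar>c\<bar>"
    using ex_translate_small[of c d] c by auto
  have "4 * (d + n * c)\<^sup>2 \<le> c\<^sup>2"
    using power_mono[OF n, of 2] by (simp add: power_mult_distrib)
  \<comment> \<open>In the second shape the translated entry is \<open>sqrt m * (d + n * c)\<close>,
    which accounts for the factor \<open>m\<close> in its square.\<close>
  then have "m * (4 * (d + n * c)\<^sup>2) \<le> m * c\<^sup>2" using m by (intro mult_left_mono) auto
  also have "\<dots> < 4 * c\<^sup>2" using m c by (intro mult_strict_right_mono) auto
  finally have "m * (d + n * c)\<^sup>2 < c\<^sup>2" by simp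
  then have "real_of_int (m * (d + n * c)\<^sup>2) < real_of_int (c\<^sup>2)" by linarith
  moreover have "(A$2$2 + n * sqrt m * A$2$1)\<^sup>2 = (sqrt m * (d + n * c))\<^sup>2"
    using 2 by (simp add: algebra_simps)
  ultimately show ?thesis using m 2 by (intro that[of n]) (simp add: power_mult_distrib)
qed

text \<open>The squared lower left entry is \<open>m * c\<^sup>2\<close> or
  \<open>c\<^sup>2\<close>, hence a natural number that can serve as the measure of the
  descent.\<close>

lemma hecke_matrix_lower_left_square:
  assumes "m \<ge> 0" "hecke_matrix m A"
  obtains N :: nat where "(A$2$1)\<^sup>2 = real N"
  using assms(2)
proof (cases rule: hecke_matrix_cases)
  case (1 a b c d)
  then show ?thesis using assms(1) by (intro that[of "nat (m * c\<^sup>2)"]) (simp add: power_mult_distrib)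
next
  case (2 a b c d)
  then show ?thesis using assms(1) by (intro that[of "nat (c\<^sup>2)"]) simp
qed

text \<open>Strong induction on the squared lower left entry. A translation makes the lower right
  entry smaller than the lower left one, and the inversion then moves it into the lower left
  position. When that entry is 0, the second shape would make \<open>m\<close> a unit, so the matrix
  is a translation up to sign.\<close>

lemma hecke_matrix_in_hecke_group:
  assumes m: "1 < m" "m < 4"
  shows "hecke_matrix m A \<Longrightarrow> (A$2$1)\<^sup>2 = real N \<Longrightarrow> A \<in> hecke_group (sqrt m)"
proof (induction N arbitrary: A rule: less_induct)
  case (less N)
  let ?S = "mat2 0 1 (-1) (0::real)" and ?T = "\<lambda>n::int. mat2 1 (n * sqrt m) 0 1"
  have T: "hecke_matrix m (?T n)" for n
    by (rule hecke_matrixI1[of 1 1 m n 0]) auto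
  have S: "hecke_matrix m ?S"
    by (rule hecke_matrixI2[of m 0 0 1 "-1"]) auto
  show ?case
  proof (cases "A$2$1 = 0")
    case True
    show ?thesis using less.prems(1)
    proof (cases rule: hecke_matrix_cases)
      case (1 a b c d)
      note A = this
      then have [simp]: "c = 0" using True m by simp
      have "a * d = 1" using 1 by simp
      then consider "a = 1" "d = 1" | "a = -1" "d = -1" by (auto simp: zmult_eq_1_iff)
      then show ?thesis
      proof cases
        case 1
        then show ?thesis using A hecke_group_translation[of b "sqrt m"] by simp
      next
        case 2
        \<comment> \<open>The square of \<open>?S\<close> is minus the identity.\<close>
        then have "A = ?S ** ?S ** ?T (- b)" using A by simp
        then show ?thesis using hecke_group_translation[of "- b" "sqrt m"] hecke_group_gens(1) hecke_group_mult
          by metis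
      qed
    next
      case (2 a b c d)
      then have "m * (a * d) = 1" using True by simp
      then show ?thesis using m by (simp add: zmult_eq_1_iff)
    qed
  next
    case False
    obtain n :: int where n: "(A$2$2 + n * sqrt m * A$2$1)\<^sup>2 < (A$2$1)\<^sup>2"
      using hecke_matrix_reduce[OF _ m(2) less.prems(1) False] m by auto
    obtain a b c d where [simp]: "A = mat2 a b c d" using mat2_eta by blast
    let ?B = "A ** ?T n ** ?S"
    have B: "hecke_matrix m ?B"
      using less.prems(1) S T m by (intro hecke_matrix_mult) auto
    then obtain M where M: "(?B$2$1)\<^sup>2 = real M"
      using hecke_matrix_lower_left_square[of m] m by (metis less_imp_le order.trans zero_le_one)
    moreover have "?B$2$1 = - (A$2$2 + n * sqrt m * A$2$1)"
      by simp
    ultimately have "real M < real N"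
      using n less.prems(2) by (metis power2_minus)
    then have "?B \<in> hecke_group (sqrt m)"
      using less.IH[of M] B M by simp
    \<comment> \<open>Since \<open>?S\<close> has order 4, its cube is its inverse, and the right
      factor undoes \<open>?T n ** ?S\<close>.\<close>
    then have "?B ** (?S ** ?S ** ?S ** ?T (- n)) \<in> hecke_group (sqrt m)"
      by (rule hecke_group_mult) (intro hecke_group_mult hecke_group_gens hecke_group_translation)
    also have "?B ** (?S ** ?S ** ?S ** ?T (- n)) = A"
      by (simp add: algebra_simps)
    finally show ?thesis .
  qed
qed

lemma hecke_group_iff:
  assumes "1 < m" "m < 4"
  shows "A \<in> hecke_group (sqrt (of_int m)) \<longleftrightarrow> hecke_matrix m A"
  using assms hecke_group_imp_hecke_matrix[of m A] hecke_matrix_in_hecke_group[OF assms, of A]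
    hecke_matrix_lower_left_square[of m A] by force


text \<open>Take a fraction in lowest terms. If \<open>m\<close> divides the denominator, the first
  form results. Otherwise primality of \<open>m\<close> keeps \<open>m * p\<close> coprime to
  \<open>q\<close>. The Bezout coefficients \<open>u\<close> and \<open>v\<close> serve to complete
  a column to a matrix of determinant 1 on the Hecke side and to give a unit combination on the ring
  side.\<close>

lemma Rats_reduced_cases:
  fixes y :: real and m :: int
  assumes "y \<in> \<rat>" "prime m"
  obtains p c u v :: int where "c \<noteq> 0" "p * u + m * c * v = 1" "y = p / (m * c)"
  | p q u v :: int where "q \<noteq> 0" "m * p * u + q * v = 1" "y = p / q"
proof -
  obtain p q :: int where pq: "q > 0" "coprime p q" "y = of_int p / of_int q"
    using Rats_cases'[OF assms(1)] by blast
  show thesis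
  proof (cases "m dvd q")
    case True
    then obtain c where c: "q = m * c" by blast
    obtain u v where "u * p + v * q = 1"
      using bezout_int[of p q] pq(2) by auto
    then show ?thesis using pq c by (intro that(1)[of c p u v]) (auto simp: algebra_simps)
  next
    case False
    then have "coprime (m * p) q"
      using assms(2) pq(2) by (simp add: prime_imp_coprime)
    then obtain u v where "u * (m * p) + v * q = 1"
      using bezout_int[of "m * p" q] by auto
    then show ?thesis using pq by (intro that(2)[of q p u v]) (auto simp: algebra_simps)
  qed
qed

section \<open>The Farey graph of the Hecke group on its interval\<close>

definition unit_Rats :: "real set" where
  "unit_Rats = {y \<in> \<rat>. 0 \<le> y \<and> y < 1}"

context
  fixes m :: int
  assumes m: "prime m" "m < 4"
begin

lemma m_gt_1: "1 < m"
  using m(1) by (simp add: prime_gt_1_int)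

text \<open>Clearing the root from the denominator writes Moebius images as a coordinate times
  \<open>sqrt m\<close>, so that coordinates can be compared by cancelling the root.\<close>

lemma sqrt_m: "sqrt m > 0" "x / (z * sqrt m) = x / (m * z) * sqrt m"
proof -
  show pos: "sqrt m > 0"
    using m_gt_1 by simp
  have "x / (s * s * z) * s = x / (z * s)" if "s > 0" for s :: real
    using that by (simp add: divide_simps)
  from this[OF pos] show "x / (z * sqrt m) = x / (m * z) * sqrt m"
    using m_gt_1 by simp
qed

lemma moebius_hecke_matrix:
  fixes a b c d :: int
  shows "moebius (mat2 a (b * sqrt m) (c * sqrt m) d) Infty =
      (if c = 0 then Infty else Point (a / (m * c) * sqrt m))"
    and "moebius (mat2 a (b * sqrt m) (c * sqrt m) d) (Point 0) =
      (if d = 0 then Infty else Point (b / d * sqrt m))"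
    and "moebius (mat2 (a * sqrt m) b c (d * sqrt m)) Infty =
      (if c = 0 then Infty else Point (a / c * sqrt m))"
    and "moebius (mat2 (a * sqrt m) b c (d * sqrt m)) (Point 0) =
      (if d = 0 then Infty else Point (b / (m * d) * sqrt m))"
  using m_gt_1 by (simp_all add: sqrt_m(2))

lemma farey_hecke_arcs:
  "(Point (x * sqrt m), Point (y * sqrt m)) \<in> arcs (farey_hecke (hecke_group (sqrt m)))
    \<longleftrightarrow> farey_edge m x y" (is "?L \<longleftrightarrow> ?R")
proof -
  have "?L \<longleftrightarrow> (\<exists>A. hecke_matrix m A \<and> moebius A Infty = Point (x * sqrt m) \<and>
      moebius A (Point 0) = Point (y * sqrt m))"
    by (simp only: farey_hecke_def hecke_group_iff[OF m_gt_1 m(2)] pre_digraph.simps mem_Collect_eq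
        prod.inject eq_commute[of "Point _"]) blast
  also have "\<dots> \<longleftrightarrow> ?R"
  proof
    assume "\<exists>A. hecke_matrix m A \<and> moebius A Infty = Point (x * sqrt m) \<and>
      moebius A (Point 0) = Point (y * sqrt m)"
    then obtain A where A: "hecke_matrix m A" "moebius A Infty = Point (x * sqrt m)"
      "moebius A (Point 0) = Point (y * sqrt m)" by blast
    from A(1) show ?R
    proof (cases rule: hecke_matrix_cases)
      case (1 a b c d)
      then show ?thesis using A(2,3) sqrt_m(1) unfolding 1(2) moebius_hecke_matrix
        by (intro farey_edgeI1[of a d m b c])
          (auto split: if_splits simp del: times_divide_eq_left)
    next
      case (2 a b c d)
      then show ?thesis using A(2,3) sqrt_m(1) unfolding 2(2) moebius_hecke_matrix
        by (intro farey_edgeI2[of m a d b c])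
          (auto split: if_splits simp del: times_divide_eq_left)
    qed
  next
    assume ?R
    then obtain a b c d :: int where abcd: "c \<noteq> 0" "d \<noteq> 0" and
      "a * d - m * b * c = 1 \<and> x = a / (m * c) \<and> y = b / d \<or>
       m * a * d - b * c = 1 \<and> x = a / c \<and> y = b / (m * d)"
      unfolding farey_edge_def by blast
    then consider "a * d - m * b * c = 1" "x = a / (m * c)" "y = b / d" |
      "m * a * d - b * c = 1" "x = a / c" "y = b / (m * d)" by blast
    then show "\<exists>A. hecke_matrix m A \<and> moebius A Infty = Point (x * sqrt m) \<and>
      moebius A (Point 0) = Point (y * sqrt m)"
    proof cases
      case 1
      with abcd show ?thesis
        by (intro exI[of _ "mat2 a (b * sqrt m) (c * sqrt m) d"])
          (simp only: moebius_hecke_matrix if_False simp_thms hecke_matrixI1[OF 1(1) refl refl refl refl])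
    next
      case 2
      with abcd show ?thesis
        by (intro exI[of _ "mat2 (a * sqrt m) b c (d * sqrt m)"])
          (simp only: moebius_hecke_matrix if_False simp_thms hecke_matrixI2[OF 2(1) refl refl refl refl])
    qed
  qed
  finally show ?thesis .
qed

text \<open>The image of infinity is the quotient of the first column, which has a rational
  coordinate in either shape. Conversely a reduced fraction supplies a first column, and its Bezout
  coefficients fill in the second.\<close>

lemma farey_hecke_verts:
  "Point (y * sqrt m) \<in> verts (farey_hecke (hecke_group (sqrt m))) \<longleftrightarrow> y \<in> \<rat>"
proof -
  have "Point (y * sqrt m) \<in> verts (farey_hecke (hecke_group (sqrt m))) \<longleftrightarrow>
      (\<exists>A. hecke_matrix m A \<and> moebius A Infty = Point (y * sqrt m))"
    by (simp only: farey_hecke_def hecke_group_iff[OF m_gt_1 m(2)] pre_digraph.simps image_iff Bex_def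
        eq_commute[of "Point _"])
  also have "\<dots> \<longleftrightarrow> y \<in> \<rat>"
  proof
    assume "\<exists>A. hecke_matrix m A \<and> moebius A Infty = Point (y * sqrt m)"
    then obtain A where A: "hecke_matrix m A" "moebius A Infty = Point (y * sqrt m)" by blast
    from A(1) show "y \<in> \<rat>"
    proof (cases rule: hecke_matrix_cases)
      case (1 a b c d)
      then show ?thesis using A(2) sqrt_m(1) unfolding 1(2) moebius_hecke_matrix
        by (auto split: if_splits simp del: times_divide_eq_left)
    next
      case (2 a b c d)
      then show ?thesis using A(2) sqrt_m(1) unfolding 2(2) moebius_hecke_matrix
        by (auto split: if_splits simp del: times_divide_eq_left)
    qed
  next
    assume "y \<in> \<rat>"
    then show "\<exists>A. hecke_matrix m A \<and> moebius A Infty = Point (y * sqrt m)"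
      using m(1)
    proof (cases rule: Rats_reduced_cases)
      case (1 p c u v)
      then have "p * u - m * (- v) * c = 1" by (simp add: algebra_simps)
      from hecke_matrixI1[OF this refl refl refl refl] 1 show ?thesis
        by (intro exI[of _ "mat2 p (of_int (- v) * sqrt m) (c * sqrt m) u"])
          (simp only: moebius_hecke_matrix if_False simp_thms)
    next
      case (2 p q u v)
      then have "m * p * u - (- v) * q = 1" by (simp add: algebra_simps)
      from hecke_matrixI2[OF this refl refl refl refl] 2 show ?thesis
        by (intro exI[of _ "mat2 (p * sqrt m) (of_int (- v)) q (u * sqrt m)"])
          (simp only: moebius_hecke_matrix if_False simp_thms)
    qed
  qed
  finally show ?thesis .
qed

lemma farey_hecke_induced:
  "induced_on (farey_hecke (hecke_group (sqrt m))) {0..<sqrt m} =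
    \<lparr>verts = (\<lambda>y. Point (y * sqrt m)) ` unit_Rats,
     arcs = {(Point (x * sqrt m), Point (y * sqrt m)) | x y.
       x \<in> unit_Rats \<and> y \<in> unit_Rats \<and> farey_edge m x y}, tail = fst, head = snd\<rparr>"
proof (rule induced_on_parametrized)
  show "verts (farey_hecke (hecke_group (sqrt m))) \<inter> Point ` {0..<sqrt m} =
      (\<lambda>y. Point (y * sqrt m)) ` unit_Rats"
  proof (intro equalityI subsetI)
    fix P assume P: "P \<in> verts (farey_hecke (hecke_group (sqrt m))) \<inter> Point ` {0..<sqrt m}"
    then obtain x where x: "P = Point x" "0 \<le> x" "x < sqrt m" by auto
    then have *: "P = Point (x / sqrt m * sqrt m)" "0 \<le> x / sqrt m" "x / sqrt m < 1"
      using sqrt_m(1) by auto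
    then have "x / sqrt m \<in> unit_Rats"
      using P farey_hecke_verts[of "x / sqrt m"] unfolding unit_Rats_def by simp
    then show "P \<in> (\<lambda>y. Point (y * sqrt m)) ` unit_Rats"
      using *(1) by (rule rev_image_eqI)
  next
    fix P assume "P \<in> (\<lambda>y. Point (y * sqrt m)) ` unit_Rats"
    then show "P \<in> verts (farey_hecke (hecke_group (sqrt m))) \<inter> Point ` {0..<sqrt m}"
      using sqrt_m(1) by (auto simp: unit_Rats_def farey_hecke_verts)
  qed
qed (simp_all add: farey_hecke_arcs, simp_all add: farey_hecke_def)

end

section \<open>Imaginary quadratic rings\<close>

text \<open>Here \<open>e\<close> and \<open>n\<close> are the trace and the norm of
  \<open>omega d\<close>. The two identities reduce closure under multiplication and conjugation,
  and integrality of norms, to integer arithmetic.\<close>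

lemma omega_quadratic:
  obtains e n :: int where "omega d * omega d = e * omega d - n" "cnj (omega d) = e - omega d"
proof (cases "d mod 4 = 3")
  case True
  define k where "k = d div 4"
  then have d: "d = 4 * k + 3" using True by presburger
  have "complex_of_real (sqrt d) * complex_of_real (sqrt d) = of_nat d"
    by (metis of_real_mult of_real_of_nat_eq real_sqrt_mult_self abs_of_nat)
  then show ?thesis using True
    \<comment> \<open>For \<open>d = 4 * k + 3\<close> the norm \<open>(1 + d) / 4\<close> is
      \<open>k + 1\<close>.\<close>
    by (intro that[of 1 "int k + 1"]) (simp_all add: omega_def field_simps d)
next
  case False
  have "complex_of_real (sqrt d) * complex_of_real (sqrt d) = of_nat d"
    by (metis of_real_mult of_real_of_nat_eq real_sqrt_mult_self abs_of_nat)
  then show ?thesis using False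
    by (intro that[of 0 "int d"]) (simp_all add: omega_def algebra_simps)
qed

lemma quad_ring_int [simp]: "of_int a \<in> quad_ring d"
  unfolding quad_ring_def by (rule CollectI, rule exI[of _ a], rule exI[of _ 0]) simp

lemma quad_ring_omega: "omega d \<in> quad_ring d"
  unfolding quad_ring_def by (rule CollectI, rule exI[of _ 0], rule exI[of _ 1]) simp

lemma quad_ring_add: "x \<in> quad_ring d \<Longrightarrow> y \<in> quad_ring d \<Longrightarrow> x + y \<in> quad_ring d"
proof -
  assume "x \<in> quad_ring d" "y \<in> quad_ring d"
  then obtain a b a' b' :: int where "x = a + b * omega d" "y = a' + b' * omega d"
    unfolding quad_ring_def by blast
  then have "x + y = of_int (a + a') + of_int (b + b') * omega d"
    by (simp add: algebra_simps)
  then show ?thesis unfolding quad_ring_def by blast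
qed

lemma quad_ring_mult: "x \<in> quad_ring d \<Longrightarrow> y \<in> quad_ring d \<Longrightarrow> x * y \<in> quad_ring d"
proof -
  assume "x \<in> quad_ring d" "y \<in> quad_ring d"
  then obtain a b a' b' :: int where xy: "x = a + b * omega d" "y = a' + b' * omega d"
    unfolding quad_ring_def by blast
  obtain e n :: int where w: "omega d * omega d = e * omega d - n"
    using omega_quadratic by blast
  have "x * y = a * a' + (a * b' + a' * b) * omega d + b * b' * (omega d * omega d)"
    unfolding xy by (simp add: algebra_simps)
  also have "\<dots> = of_int (a * a' - b * b' * n) + of_int (a * b' + a' * b + b * b' * e) * omega d"
    unfolding w by (simp add: algebra_simps)
  finally show ?thesis unfolding quad_ring_def by blast
qed

lemma quad_ring_minus: "x \<in> quad_ring d \<Longrightarrow> - x \<in> quad_ring d"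
  using quad_ring_mult[OF quad_ring_int[of "-1"]] by simp

lemma quad_ring_diff: "x \<in> quad_ring d \<Longrightarrow> y \<in> quad_ring d \<Longrightarrow> x - y \<in> quad_ring d"
  using quad_ring_add[OF _ quad_ring_minus] by fastforce

lemma quad_ring_cnj: "x \<in> quad_ring d \<Longrightarrow> cnj x \<in> quad_ring d"
proof -
  assume "x \<in> quad_ring d"
  then obtain a b :: int where x: "x = a + b * omega d"
    unfolding quad_ring_def by blast
  obtain e n :: int where e: "cnj (omega d) = e - omega d"
    using omega_quadratic by blast
  have "cnj x = of_int (a + b * e) + of_int (- b) * omega d"
    unfolding x by (simp add: e) (simp add: algebra_simps)
  then show ?thesis unfolding quad_ring_def by blast
qed

lemmas quad_ring_closed = quad_ring_add quad_ring_mult quad_ring_minus quad_ring_diff quad_ring_cnj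

lemma quad_ring_norm:
  assumes "x \<in> quad_ring d"
  obtains k :: int where "x * cnj x = k"
proof -
  obtain a b :: int where x: "x = a + b * omega d"
    using assms unfolding quad_ring_def by blast
  obtain e n :: int where w: "omega d * omega d = e * omega d - n" "cnj (omega d) = e - omega d"
    using omega_quadratic by blast
  have "x * cnj x = a * a + a * b * e + b * b * (e * omega d - omega d * omega d)"
    unfolding x by (simp add: w(2)) (simp add: algebra_simps)
  also have "\<dots> = of_int (a * a + a * b * e + b * b * n)"
    unfolding w(1) by (simp add: algebra_simps)
  finally show thesis by (rule that)
qed

text \<open>Norms are integers and multiply, so the norm of a divisor of 1 divides 1.\<close>

lemma quad_ring_dvd_1_norm:
  assumes "x \<in> quad_ring d" "y \<in> quad_ring d" "x * y = 1" "x * cnj x = of_int k"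
  shows "\<bar>k\<bar> = 1"
proof -
  obtain l :: int where l: "y * cnj y = l"
    using quad_ring_norm assms(2) by blast
  have "of_int (k * l) = (x * y) * cnj (x * y)"
    by (simp add: mult_ac flip: assms(4) l)
  then have "of_int (k * l) = (1 :: complex)"
    by (simp add: assms(3))
  then have "k * l = 1"
    by (metis of_int_eq_1_iff)
  then show ?thesis by (auto simp: zmult_eq_1_iff)
qed

lemma quad_field_iff:
  assumes "d > 0"
  shows "z \<in> quad_field d \<longleftrightarrow> Re z \<in> \<rat> \<and> Im z / sqrt d \<in> \<rat>"
proof
  assume "z \<in> quad_field d"
  then obtain a b where z: "z = of_rat a + of_rat b * (\<i> * sqrt (real d))"
    unfolding quad_field_def by blast
  have "of_rat r = complex_of_real (of_rat r)" for r
    by (simp add: of_rat_def)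
  then have "z = complex_of_real (of_rat a) + complex_of_real (of_rat b) * (\<i> * sqrt (real d))"
    using z by metis
  then show "Re z \<in> \<rat> \<and> Im z / sqrt d \<in> \<rat>" using assms by simp
next
  assume "Re z \<in> \<rat> \<and> Im z / sqrt d \<in> \<rat>"
  then obtain a b where ab: "Re z = of_rat a" "Im z / sqrt d = of_rat b"
    by (metis Rats_cases)
  have "of_rat r = complex_of_real (of_rat r)" for r
    by (simp add: of_rat_def)
  moreover have "z = complex_of_real (Re z) + complex_of_real (Im z / sqrt d) * (\<i> * sqrt (real d))"
    using assms by (simp add: complex_eq_iff)
  ultimately have "z = of_rat a + of_rat b * (\<i> * sqrt (real d))"
    using ab by metis
  then show "z \<in> quad_field d" unfolding quad_field_def by blast
qed

lemma quad_ring_subset_quad_field: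
  assumes "d > 0" "x \<in> quad_ring d"
  shows "x \<in> quad_field d"
proof -
  have "Re (omega d) \<in> \<rat>" "Im (omega d) / sqrt d \<in> \<rat>"
    using assms(1) by (auto simp: omega_def)
  moreover obtain a b :: int where "x = a + b * omega d"
    using assms(2) unfolding quad_ring_def by blast
  ultimately show ?thesis
    using assms(1) by (simp add: quad_field_iff flip: times_divide_eq_right)
qed

section \<open>Arcs over the quadratic ring\<close>

lemma farey_quad_arcs:
  "(Point z, Point w) \<in> arcs (farey_quad n) \<longleftrightarrow>
    (\<exists>a b c d. a \<in> quad_ring n \<and> b \<in> quad_ring n \<and> c \<in> quad_ring n \<and> d \<in> quad_ring n \<and>
      a * d - b * c = 1 \<and> c \<noteq> 0 \<and> d \<noteq> 0 \<and> z = a / c \<and> w = b / d)" (is "_ \<longleftrightarrow> ?R")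
proof -
  \<comment> \<open>Every element of the quotient is the coset of some matrix \<open>A\<close>, so
    \<open>psl_act_coset\<close> lets matrices replace cosets.\<close>
  have carrier: "carrier (PSL2 (quad_ring n)) =
      (\<lambda>A. {mat 1, - mat 1} #>\<^bsub>SL2 (quad_ring n)\<^esub> A) ` carrier (SL2 (quad_ring n))"
    by (auto simp: PSL2_def FactGroup_def RCOSETS_def)
  have "arcs (farey_quad n) =
      (\<lambda>X. (psl_act X Infty, psl_act X (Point 0))) ` carrier (PSL2 (quad_ring n))"
    by (auto simp: farey_quad_def)
  also have "\<dots> = (\<lambda>A. (moebius A Infty, moebius A (Point 0))) ` carrier (SL2 (quad_ring n))"
    by (simp only: carrier image_image psl_act_coset)
  finally have "arcs (farey_quad n) = \<dots>" .
  then have "(Point z, Point w) \<in> arcs (farey_quad n) \<longleftrightarrow>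
     (\<exists>A \<in> carrier (SL2 (quad_ring n)). moebius A Infty = Point z \<and> moebius A (Point 0) = Point w)"
    by (simp only: image_iff prod.inject eq_commute[of "Point _"])
  also have "\<dots> \<longleftrightarrow> ?R"
  proof
    assume "\<exists>A \<in> carrier (SL2 (quad_ring n)). moebius A Infty = Point z \<and> moebius A (Point 0) = Point w"
    then obtain a b c d where "mat2 a b c d \<in> carrier (SL2 (quad_ring n))"
      "moebius (mat2 a b c d) Infty = Point z" "moebius (mat2 a b c d) (Point 0) = Point w"
      using mat2_eta by metis
    then show ?R
      by (rule_tac exI[of _ a], rule_tac exI[of _ b], rule_tac exI[of _ c], rule_tac exI[of _ d])
        (auto split: if_splits)
  next
    assume ?R
    then obtain a b c d where "a \<in> quad_ring n" "b \<in> quad_ring n" "c \<in> quad_ring n" "d \<in> quad_ring n"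
      "a * d - b * c = 1" "c \<noteq> 0" "d \<noteq> 0" "z = a / c" "w = b / d" by blast
    then show "\<exists>A \<in> carrier (SL2 (quad_ring n)). moebius A Infty = Point z \<and> moebius A (Point 0) = Point w"
      by (intro bexI[of _ "mat2 a b c d"]) auto
  qed
  finally show ?thesis .
qed


text \<open>Left multiplication by the unipotent matrix of \<open>t\<close> adds \<open>t\<close>
  times the lower row to the upper row and preserves the determinant.\<close>

lemma farey_quad_arcs_translate:
  assumes "t \<in> quad_ring n" "(Point z, Point w) \<in> arcs (farey_quad n)"
  shows "(Point (t + z), Point (t + w)) \<in> arcs (farey_quad n)"
proof -
  obtain a b c d where *: "a \<in> quad_ring n" "b \<in> quad_ring n" "c \<in> quad_ring n" "d \<in> quad_ring n"
    "a * d - b * c = 1" "c \<noteq> 0" "d \<noteq> 0" "z = a / c" "w = b / d"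
    using assms(2) unfolding farey_quad_arcs by blast
  show ?thesis unfolding farey_quad_arcs
  proof (intro exI conjI)
    show "a + t * c \<in> quad_ring n" "b + t * d \<in> quad_ring n" "c \<in> quad_ring n" "d \<in> quad_ring n"
      using * assms(1) by (auto intro!: quad_ring_closed)
  qed (use * in \<open>auto simp: field_simps\<close>)
qed

lemma farey_quad_arcs_translate_iff:
  assumes "t \<in> quad_ring n"
  shows "(Point (t + z), Point (t + w)) \<in> arcs (farey_quad n) \<longleftrightarrow>
    (Point z, Point w) \<in> arcs (farey_quad n)"
  using farey_quad_arcs_translate[OF assms, of z w]
    farey_quad_arcs_translate[OF quad_ring_minus[OF assms], of "t + z" "t + w"] by auto

text \<open>The Bezout relation for the reduced pair yields the common factor explicitly as
  \<open>a * x + c * y\<close>; cross multiplication verifies it.\<close>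

lemma quad_ring_reduced_unique:
  assumes "a \<in> quad_ring n" "c \<in> quad_ring n" "x \<in> quad_ring n" "y \<in> quad_ring n"
    and "a' * x + c' * y = 1" "c \<noteq> 0" "c' \<noteq> 0" "a / c = a' / c'"
  obtains u where "u \<in> quad_ring n" "a = u * a'" "c = u * c'"
proof
  have ac: "a * c' = a' * c"
    using assms(6-8) by (simp add: field_simps)
  show "a * x + c * y \<in> quad_ring n"
    using assms(1-4) by (auto intro!: quad_ring_closed)
  have "(a * x + c * y) * a' = a * (a' * x) + (a' * c) * y" by (simp add: algebra_simps)
  also have "\<dots> = a * (a' * x + c' * y)" unfolding ac[symmetric] by (simp add: algebra_simps)
  finally show "a = (a * x + c * y) * a'" using assms(5) by simp
  have "(a * x + c * y) * c' = (a * c') * x + c * (c' * y)" by (simp add: algebra_simps)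
  also have "\<dots> = c * (a' * x + c' * y)" unfolding ac by (simp add: algebra_simps)
  finally show "c = (a * x + c * y) * c'" using assms(5) by simp
qed

text \<open>The matrix realizing the arc has columns that are multiples, by ring elements
  \<open>u\<close> and \<open>v\<close>, of the given reduced columns. Its determinant 1 is
  therefore \<open>u * v\<close> times the determinant of the reduced columns.\<close>

lemma farey_quad_arc_det_unit:
  assumes "(Point (a / c), Point (b / d)) \<in> arcs (farey_quad n)"
    and "c \<noteq> 0" "d \<noteq> 0" "a * x + c * y = 1" "b * x' + d * y' = 1"
    and "x \<in> quad_ring n" "y \<in> quad_ring n" "x' \<in> quad_ring n" "y' \<in> quad_ring n"
  obtains r where "r \<in> quad_ring n" "(a * d - b * c) * r = 1"
proof -
  obtain a0 b0 c0 d0 where *: "a0 \<in> quad_ring n" "b0 \<in> quad_ring n" "c0 \<in> quad_ring n"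
    "d0 \<in> quad_ring n" "a0 * d0 - b0 * c0 = 1" "c0 \<noteq> 0" "d0 \<noteq> 0" "a / c = a0 / c0" "b / d = b0 / d0"
    using assms(1) unfolding farey_quad_arcs by blast
  obtain u where u: "u \<in> quad_ring n" "a0 = u * a" "c0 = u * c"
    using quad_ring_reduced_unique[OF *(1,3) assms(6,7,4) *(6) assms(2)] *(8) by metis
  obtain v where v: "v \<in> quad_ring n" "b0 = v * b" "d0 = v * d"
    using quad_ring_reduced_unique[OF *(2,4) assms(8,9,5) *(7) assms(3)] *(9) by metis
  have "(a * d - b * c) * (u * v) = 1"
    using *(5) unfolding u v by (simp add: algebra_simps)
  then show thesis using that quad_ring_mult u(1) v(1) by blast
qed

section \<open>Segments in a direction of prime norm\<close>

context
  fixes n :: nat and m :: int and \<theta> :: complex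
  assumes n: "n > 0" and \<theta>: "\<theta> \<in> quad_ring n" "\<theta> * cnj \<theta> = of_int m" and m: "prime m"
begin

lemma theta_nonzero: "\<theta> \<noteq> 0" "cnj \<theta> \<noteq> 0" "m \<noteq> 0"
  using \<theta>(2) m by auto

lemma theta_div: "z / of_int m * \<theta> = z / cnj \<theta>"
  using theta_nonzero by (simp flip: \<theta>(2))

lemma farey_edge_imp_farey_quad_arc:
  assumes "farey_edge m x y"
  shows "(Point (of_real x * \<theta>), Point (of_real y * \<theta>)) \<in> arcs (farey_quad n)"
proof -
  obtain a b c d :: int where nz: "c \<noteq> 0" "d \<noteq> 0" and
    "a * d - m * b * c = 1 \<and> x = a / (m * c) \<and> y = b / d \<or>
     m * a * d - b * c = 1 \<and> x = a / c \<and> y = b / (m * d)"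
    using assms unfolding farey_edge_def by blast
  then consider "a * d - m * b * c = 1" "x = a / (m * c)" "y = b / d" |
    "m * a * d - b * c = 1" "x = a / c" "y = b / (m * d)" by blast
  then show ?thesis
  proof cases
    case 1
    have "complex_of_int (a * d - m * b * c) = 1" using 1(1) by simp
    \<comment> \<open>The factor \<open>m\<close> is split as
      \<open>\<theta> * cnj \<theta>\<close>, with \<open>\<theta>\<close> going to the upper row
      and its conjugate to the lower row.\<close>
    then have det: "of_int a * of_int d - (of_int b * \<theta>) * (of_int c * cnj \<theta>) = 1"
      by (simp add: mult_ac flip: \<theta>(2))
    show ?thesis unfolding farey_quad_arcs
    proof (intro exI conjI)
      show "of_int a * of_int d - (of_int b * \<theta>) * (of_int c * cnj \<theta>) = 1" by (fact det)
      show "of_real x * \<theta> = of_int a / (of_int c * cnj \<theta>)"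
        using 1(2) theta_div[of "of_int a / of_int c"] by (simp add: mult_ac)
    qed (use nz 1 theta_nonzero \<theta>(1) in \<open>auto intro!: quad_ring_closed\<close>)
  next
    case 2
    have "complex_of_int (m * a * d - b * c) = 1" using 2(1) by simp
    then have det: "(of_int a * \<theta>) * (of_int d * cnj \<theta>) - of_int b * of_int c = 1"
      by (simp add: mult_ac flip: \<theta>(2))
    show ?thesis unfolding farey_quad_arcs
    proof (intro exI conjI)
      show "(of_int a * \<theta>) * (of_int d * cnj \<theta>) - of_int b * of_int c = 1" by (fact det)
      show "of_real y * \<theta> = of_int b / (of_int d * cnj \<theta>)"
        using 2(3) theta_div[of "of_int b / of_int d"] by (simp add: mult_ac)
    qed (use nz 2 theta_nonzero \<theta>(1) in \<open>auto intro!: quad_ring_closed\<close>)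
  qed
qed

text \<open>In the integer Bezout relation \<open>m\<close> is split in the same way. One factor
  stays with the fraction, and the other is absorbed into a coefficient, which is why
  \<open>u\<close> and \<open>v\<close> are now ring elements instead of integers.\<close>

lemma theta_point_reduced_cases:
  fixes x :: real
  assumes "x \<in> \<rat>"
  obtains p c :: int and u v where "c \<noteq> 0" "x = p / (m * c)"
    "of_real x * \<theta> = of_int p / (of_int c * cnj \<theta>)"
    "u \<in> quad_ring n" "v \<in> quad_ring n" "of_int p * u + of_int c * cnj \<theta> * v = 1"
  | p q :: int and u v where "q \<noteq> 0" "x = p / q"
    "of_real x * \<theta> = of_int p * \<theta> / of_int q"
    "u \<in> quad_ring n" "v \<in> quad_ring n" "of_int p * \<theta> * u + of_int q * v = 1"
  using assms m
proof (cases rule: Rats_reduced_cases)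
  case (1 p c u v)
  have "complex_of_int (p * u + m * c * v) = 1" using 1(2) by simp
  then have "of_int p * of_int u + of_int c * cnj \<theta> * (\<theta> * of_int v) = 1"
    by (simp add: mult_ac flip: \<theta>(2))
  moreover have "of_real x * \<theta> = of_int p / (of_int c * cnj \<theta>)"
    using 1(3) theta_div[of "of_int p / of_int c"] by (simp add: mult_ac)
  ultimately show ?thesis
    using 1 \<theta>(1) quad_ring_mult by (intro that(1)) auto
next
  case (2 p q u v)
  have "complex_of_int (m * p * u + q * v) = 1" using 2(2) by simp
  then have "of_int p * \<theta> * (cnj \<theta> * of_int u) + of_int q * of_int v = 1"
    by (simp add: mult_ac flip: \<theta>(2))
  then show ?thesis
    using 2 \<theta>(1) quad_ring_mult quad_ring_cnj by (intro that(2)) auto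
qed

lemma int_unit_quad_ring:
  assumes "of_int k * r = 1" "r \<in> quad_ring n"
  shows "k = 1 \<or> k = -1"
proof -
  have "\<bar>k * k\<bar> = 1"
    using assms by (intro quad_ring_dvd_1_norm[of "of_int k" n r]) auto
  then show ?thesis by (auto simp: zmult_eq_1_iff)
qed

text \<open>The norm of such a unit would be \<open>k * k * m\<close>, a multiple of the prime
  \<open>m\<close>.\<close>

lemma theta_multiple_not_unit:
  assumes "of_int k * \<theta> * r = 1" "r \<in> quad_ring n"
  shows False
proof -
  have "of_int k * \<theta> * cnj (of_int k * \<theta>) = of_int (k * k * m)"
    by (simp add: mult_ac flip: \<theta>(2))
  then have "\<bar>k * k * m\<bar> = 1"
    using assms \<theta>(1) by (intro quad_ring_dvd_1_norm[of "of_int k * \<theta>" n r]) (auto intro: quad_ring_mult)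
  then show False
    using prime_gt_1_int[OF m] by (auto simp: abs_mult zmult_eq_1_iff)
qed

lemma theta_cnj_multiple_not_unit:
  assumes "of_int k * cnj \<theta> * r = 1" "r \<in> quad_ring n"
  shows False
proof (rule theta_multiple_not_unit)
  show "of_int k * \<theta> * cnj r = 1"
    using arg_cong[OF assms(1), of cnj] by simp
qed (use assms(2) in \<open>rule quad_ring_cnj\<close>)

lemma farey_quad_arc_imp_farey_edge:
  assumes xy: "x \<in> \<rat>" "y \<in> \<rat>"
    and arc: "(Point (of_real x * \<theta>), Point (of_real y * \<theta>)) \<in> arcs (farey_quad n)"
  shows "farey_edge m x y"
  using xy(1)
proof (cases rule: theta_point_reduced_cases)
  case (1 p c u v)
  note X = this
  show ?thesis using xy(2)
  proof (cases rule: theta_point_reduced_cases)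
    case (1 r e u' v')
    obtain w where w: "w \<in> quad_ring n"
      "(of_int p * (of_int e * cnj \<theta>) - of_int r * (of_int c * cnj \<theta>)) * w = 1"
      using farey_quad_arc_det_unit[OF arc[unfolded X(3) 1(3)] _ _ X(6) 1(6) X(4,5) 1(4,5)]
        X(1) 1(1) theta_nonzero by auto
    \<comment> \<open>Equal shapes: both terms share the factor \<open>cnj \<theta>\<close>, which
      cannot divide 1.\<close>
    have "of_int (p * e - r * c) * cnj \<theta> * w = 1"
      using w(2) by (simp add: algebra_simps)
    then show ?thesis using theta_cnj_multiple_not_unit w(1) by blast
  next
    case (2 r s u' v')
    obtain w where w: "w \<in> quad_ring n"
      "(of_int p * of_int s - of_int r * \<theta> * (of_int c * cnj \<theta>)) * w = 1"
      using farey_quad_arc_det_unit[OF arc[unfolded X(3) 2(3)] _ _ X(6) 2(6) X(4,5) 2(4,5)]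
        X(1) 2(1) theta_nonzero by auto
    \<comment> \<open>Different shapes: \<open>\<theta>\<close> meets its conjugate, so the
      determinant is an integer that is a unit of the ring, hence 1 or -1.\<close>
    have "of_int (p * s - m * r * c) * w = 1"
      using w(2) by (simp add: mult_ac flip: \<theta>(2))
    from int_unit_quad_ring[OF this w(1)] show ?thesis
      using X(1,2) 2(1,2) by (intro farey_edgeI1)
  qed
next
  case (2 p q u v)
  note X = this
  show ?thesis using xy(2)
  proof (cases rule: theta_point_reduced_cases)
    case (1 r e u' v')
    obtain w where w: "w \<in> quad_ring n"
      "(of_int p * \<theta> * (of_int e * cnj \<theta>) - of_int r * of_int q) * w = 1"
      using farey_quad_arc_det_unit[OF arc[unfolded X(3) 1(3)] _ _ X(6) 1(6) X(4,5) 1(4,5)]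
        X(1) 1(1) theta_nonzero by auto
    have "of_int (m * p * e - r * q) * w = 1"
      using w(2) by (simp add: mult_ac flip: \<theta>(2))
    from int_unit_quad_ring[OF this w(1)] show ?thesis
      using X(1,2) 1(1,2) by (intro farey_edgeI2)
  next
    case (2 r s u' v')
    have "complex_of_int q \<noteq> 0" "complex_of_int s \<noteq> 0"
      using X(1) 2(1) by simp_all
    then obtain w where w: "w \<in> quad_ring n"
      "(of_int p * \<theta> * of_int s - of_int r * \<theta> * of_int q) * w = 1"
      using farey_quad_arc_det_unit[OF arc[unfolded X(3) 2(3)] _ _ X(6) 2(6) X(4,5) 2(4,5)]
      by blast
    have "of_int (p * s - r * q) * \<theta> * w = 1"
      using w(2) by (simp add: algebra_simps)
    then show ?thesis using theta_multiple_not_unit w(1) by blast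
  qed
qed

lemma farey_quad_verts:
  assumes t: "t \<in> quad_ring n" and im: "Im \<theta> \<noteq> 0"
  shows "Point (t + of_real y * \<theta>) \<in> verts (farey_quad n) \<longleftrightarrow> y \<in> \<rat>"
proof -
  have t': "Re t \<in> \<rat>" "Im t / sqrt n \<in> \<rat>" and \<theta>': "Re \<theta> \<in> \<rat>" "Im \<theta> / sqrt n \<in> \<rat>"
    using quad_ring_subset_quad_field[OF n] t \<theta>(1) n by (auto simp: quad_field_iff)
  have "y \<in> \<rat>" if "Im (t + of_real y * \<theta>) / sqrt n \<in> \<rat>"
  proof -
    \<comment> \<open>Since \<open>\<theta>\<close> is not real, \<open>y\<close> can be recovered
      from imaginary parts; dividing each of them by \<open>sqrt n\<close> makes them
      rational.\<close>
    have "y = (Im (t + of_real y * \<theta>) / sqrt n - Im t / sqrt n) / (Im \<theta> / sqrt n)"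
      using n im by (simp add: field_simps)
    also have "\<dots> \<in> \<rat>"
      by (rule Rats_divide[OF Rats_diff[OF that t'(2)] \<theta>'(2)])
    finally show ?thesis .
  qed
  moreover have "Re (t + of_real y * \<theta>) \<in> \<rat>" "Im (t + of_real y * \<theta>) / sqrt n \<in> \<rat>" if "y \<in> \<rat>"
    using that t' \<theta>' by (auto simp: add_divide_distrib simp flip: times_divide_eq_right)
  ultimately show ?thesis
    unfolding farey_quad_def using quad_field_iff[OF n] by auto
qed

lemma farey_quad_induced:
  assumes t: "t \<in> quad_ring n" and im: "Im \<theta> \<noteq> 0"
  shows "induced_on (farey_quad n) {t + of_real y * \<theta> | y. 0 \<le> y \<and> y < 1} =
    \<lparr>verts = (\<lambda>y. Point (t + of_real y * \<theta>)) ` unit_Rats,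
     arcs = {(Point (t + of_real x * \<theta>), Point (t + of_real y * \<theta>)) | x y.
       x \<in> unit_Rats \<and> y \<in> unit_Rats \<and> farey_edge m x y}, tail = fst, head = snd\<rparr>"
proof (rule induced_on_parametrized)
  show "verts (farey_quad n) \<inter> Point ` {t + of_real y * \<theta> | y. 0 \<le> y \<and> y < 1} =
      (\<lambda>y. Point (t + of_real y * \<theta>)) ` unit_Rats"
    using farey_quad_verts[OF assms] by (auto simp: unit_Rats_def)
  fix x y assume "x \<in> unit_Rats" "y \<in> unit_Rats"
  then show "(Point (t + of_real x * \<theta>), Point (t + of_real y * \<theta>)) \<in> arcs (farey_quad n)
      \<longleftrightarrow> farey_edge m x y"
    using farey_edge_imp_farey_quad_arc farey_quad_arc_imp_farey_edge
    by (auto simp: unit_Rats_def farey_quad_arcs_translate_iff[OF t])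
qed (simp_all add: farey_quad_def)

text \<open>Both induced graphs are parametrized by \<open>unit_Rats\<close> with the same edge
  relation \<open>farey_edge m\<close>, so matching coordinates is an isomorphism.\<close>

lemma farey_quad_iso_farey_hecke:
  assumes t: "t \<in> quad_ring n" and im: "Im \<theta> \<noteq> 0" and "m < 4"
  shows "digraph_iso (induced_on (farey_quad n) {t + of_real y * \<theta> | y. 0 \<le> y \<and> y < 1})
    (induced_on (farey_hecke (hecke_group (sqrt m))) {0..<sqrt m})"
proof (rule digraph_iso_parametrized)
  show "inj_on (\<lambda>y. Point (t + of_real y * \<theta>)) unit_Rats"
    using theta_nonzero by (auto intro!: inj_onI)
  show "inj_on (\<lambda>y. Point (y * sqrt m)) unit_Rats"
    using theta_nonzero by (auto intro!: inj_onI)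
qed (fact farey_quad_induced[OF t im] farey_hecke_induced[OF m \<open>m < 4\<close>])+

end

section \<open>The rings for d = 2, 7 and 11\<close>

lemma omega_norms:
  "omega 2 * cnj (omega 2) = of_int 2" "omega 7 * cnj (omega 7) = of_int 2"
  "(omega 7 - 1) * cnj (omega 7 - 1) = of_int 2"
  "omega 11 * cnj (omega 11) = of_int 3" "(omega 11 - 1) * cnj (omega 11 - 1) = of_int 3"
  unfolding complex_mult_cnj by (simp_all add: omega_def power_divide)

theorem theorem3:
  shows
    "(digraph_iso (induced_on (farey_quad 2) {of_real y * omega 2 | y. 0 \<le> y \<and> y < 1}) farey_I4 \<and>
      digraph_iso (induced_on (farey_quad 2) {1 + of_real y * omega 2 | y. 0 \<le> y \<and> y < 1}) farey_I4) \<and>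
     (digraph_iso (induced_on (farey_quad 7) {of_real y * omega 7 | y. 0 \<le> y \<and> y < 1}) farey_I4 \<and>
      digraph_iso (induced_on (farey_quad 7) {1 + of_real y * (omega 7 - 1) | y. 0 \<le> y \<and> y < 1}) farey_I4) \<and>
     (digraph_iso (induced_on (farey_quad 11) {of_real y * omega 11 | y. 0 \<le> y \<and> y < 1}) farey_I6 \<and>
      digraph_iso (induced_on (farey_quad 11) {1 + of_real y * (omega 11 - 1) | y. 0 \<le> y \<and> y < 1}) farey_I6)"
proof -
  have int: "0 \<in> quad_ring n" "1 \<in> quad_ring n" "omega n - 1 \<in> quad_ring n" for n
    using quad_ring_int[of 0 n] quad_ring_int[of 1 n] quad_ring_diff[OF quad_ring_omega, of 1 n] by auto
  have im: "Im (omega 2) \<noteq> 0" "Im (omega 7) \<noteq> 0" "Im (omega 11) \<noteq> 0"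
    by (simp_all add: omega_def)
  \<comment> \<open>Each segment is given by its start \<open>t\<close>, which is 0 or 1, and its
    direction \<open>\<theta>\<close>. Norm 2 leads to \<open>H4\<close> and norm 3 to
    \<open>H6\<close>.\<close>
  note iso = farey_quad_iso_farey_hecke
  show ?thesis
    unfolding farey_I4_def farey_I6_def H4_def H6_def
    using iso[OF _ quad_ring_omega omega_norms(1) _ int(1)] iso[OF _ quad_ring_omega omega_norms(1) _ int(2)]
      iso[OF _ quad_ring_omega omega_norms(2) _ int(1)] iso[OF _ int(3) omega_norms(3) _ int(2)]
      iso[OF _ quad_ring_omega omega_norms(4) _ int(1)] iso[OF _ int(3) omega_norms(5) _ int(2)] im
    by simp
qed

end
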